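(* Let $N\in\mathbb N$, $\tau\in(0,1/2)$, $\delta=\tau N$, $\lambda\ge 0$, $L=N(1+\lambda)$, $m\in\mathbb N\setminus\{1\}$, and $f\in\mathcal B_\delta(\mathbb R)$. Let $s=\left\lceil\frac{m+1}{2}\right\rceil$. Let $\varepsilon>0$ and $\tilde f_\ell=f\big(\frac{\ell}{L}\big)+\varepsilon_\ell$ with $|\varepsilon_\ell|\le\varepsilon$ for all $\ell\in\mathbb Z$. Let $R_{\mathrm B,m}f$ and $R_{\mathrm B,m}\tilde f$ be the regularized Shannon sampling formulas with exact and with noisy samples for the B-spline window function $\varphi_{\mathrm B}(x)=\frac{1}{M_{2s}(0)}M_{2s}\big(\frac{Lxs}{m}\big)$. Then $$\|R_{\mathrm B,m}\tilde f-R_{\mathrm B,m}f\|_{C_0(\mathbb R)}\le\varepsilon\left(2+\frac32\sqrt m\right).$$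
   Context: $\mathrm{sinc}\,x=\frac{\sin x}{x}$ for $x\ne0$ and $\mathrm{sinc}\,0=1$. $\|g\|_{C_0(\mathbb R)}:=\max_{t\in\mathbb R}|g(t)|$ (read as a supremum if the maximum is not attained). Fourier transform: $\hat f(v)=\int_{\mathbb R}f(t)\,\mathrm e^{-2\pi\mathrm i tv}\,\mathrm dt$ (extended to $L^2(\mathbb R)$ by Plancherel). Paley--Wiener space: $\mathcal B_\delta(\mathbb R)=\{f\in L^2(\mathbb R):\ \mathrm{supp}\,\hat f\subseteq[-\delta,\delta]\}$; each element is identified with its smooth representative, so point values make sense. $M_{2s}$ denotes the centered cardinal B-spline of even order $2s$, i.e. the $2s$-fold convolution of the indicator function of $[-\frac12,\frac12]$ with itself (so $M_{2s}$ is supported on $[-s,s]$), with Fourier transform $v\mapsto(\mathrm{sinc}(\pi v))^{2s}$. For a real or complex sequence $(g_\ell)_{\ell\in\mathbb Z}$ the regularized Shannon sampling formula with localized sampling for the B-spline window is $$t\mapsto\sum_{\ell\in\mathbb Z}g_\ell\,\mathrm{sinc}\big(L\pi(t-\tfrac{\ell}{L})\big)\,\varphi_{\mathrm B}\big(t-\tfrac{\ell}{L}\big)\,\mathbf 1_{[-m/L,m/L]}\big(t-\tfrac{\ell}{L}\big),\quad t\in\mathbb R,$$ where $\mathbf 1_{[-m/L,m/L]}$ is the indicator function of $[-m/L,m/L]$; it is denoted $R_{\mathrm B,m}f$ when $g_\ell=f(\ell/L)$ and $R_{\mathrm B,m}\tilde f$ when $g_\ell=\tilde f_\ell$. *)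

theory Defs
  imports "HOL-Probability.Sinc_Integral"
begin

definition square_integrable :: "(real \<Rightarrow> complex) \<Rightarrow> bool" where
  "square_integrable f \<longleftrightarrow>
     f \<in> borel_measurable lborel \<and> integrable lborel (\<lambda>t. (cmod (f t))\<^sup>2)"

(* Convergence in the L2 norm, with the extended nonnegative integral so that
   no integrability side conditions can be lost. *)
definition L2_tendsto :: "(nat \<Rightarrow> real \<Rightarrow> complex) \<Rightarrow> (real \<Rightarrow> complex) \<Rightarrow> bool" where
  "L2_tendsto g f \<longleftrightarrow>
     (\<lambda>n. \<integral>\<^sup>+ t. ennreal ((cmod (g n t - f t))\<^sup>2) \<partial>lborel) \<longlonglongrightarrow> 0"

definition fourier_integral :: "(real \<Rightarrow> complex) \<Rightarrow> real \<Rightarrow> complex" where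
  "fourier_integral f v =
     (\<integral>t. f t * exp (- 2 * of_real pi * \<i> * of_real t * of_real v) \<partial>lborel)"

(* F represents the Fourier transform of f in L2, i.e. the value at f of the
   L2-continuous extension of the Fourier integral from the intersection of L1 and L2.
   F is determined only up to equality almost everywhere. *)
definition fourier_plancherel :: "(real \<Rightarrow> complex) \<Rightarrow> (real \<Rightarrow> complex) \<Rightarrow> bool" where
  "fourier_plancherel f F \<longleftrightarrow>
     square_integrable f \<and> square_integrable F \<and>
     (\<exists>g. (\<forall>n. integrable lborel (g n) \<and> square_integrable (g n)) \<and>
          L2_tendsto g f \<and> L2_tendsto (\<lambda>n. fourier_integral (g n)) F)"

(* The support of an almost-everywhere class: the complement of the largest open set
   on which F vanishes almost everywhere. *)
definition ess_support :: "(real \<Rightarrow> complex) \<Rightarrow> real set" where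
  "ess_support F = - \<Union> {U. open U \<and> (AE v in lborel. v \<in> U \<longrightarrow> F v = 0)}"

definition smooth_fun :: "(real \<Rightarrow> complex) \<Rightarrow> bool" where
  "smooth_fun f \<longleftrightarrow>
     (\<exists>D :: nat \<Rightarrow> real \<Rightarrow> complex. D 0 = f \<and>
        (\<forall>k t. (D k has_vector_derivative D (Suc k) t) (at t)))"

(* Elements are the smooth representatives of their L2 classes, so that point values
   are meaningful. *)
definition paley_wiener :: "real \<Rightarrow> (real \<Rightarrow> complex) set" where
  "paley_wiener \<delta> =
     {f. smooth_fun f \<and> square_integrable f \<and>
         (\<exists>F. fourier_plancherel f F \<and> ess_support F \<subseteq> {-\<delta>..\<delta>})}"

definition convolve :: "(real \<Rightarrow> real) \<Rightarrow> (real \<Rightarrow> real) \<Rightarrow> real \<Rightarrow> real" where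
  "convolve f g t = (\<integral>x. f x * g (t - x) \<partial>lborel)"

definition unit_box :: "real \<Rightarrow> real" where
  "unit_box = indicator {-1/2..1/2}"

(* Centered cardinal B-spline of order n: the convolution of n copies of the unit box.
   Meaningful only for n > 0. *)
definition cardinal_bspline :: "nat \<Rightarrow> real \<Rightarrow> real" where
  "cardinal_bspline n = (convolve unit_box ^^ (n - 1)) unit_box"

definition bspline_window :: "nat \<Rightarrow> real \<Rightarrow> nat \<Rightarrow> real \<Rightarrow> real" where
  "bspline_window s L m x =
     1 / cardinal_bspline (2 * s) 0 * cardinal_bspline (2 * s) (L * x * real s / real m)"

(* For each t only finitely many summands are nonzero, so the infinite sum
   over the integers is always a genuine (finite) sum. *)
definition reg_shannon ::
    "real \<Rightarrow> nat \<Rightarrow> (real \<Rightarrow> real) \<Rightarrow> (int \<Rightarrow> complex) \<Rightarrow> real \<Rightarrow> complex" where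
  "reg_shannon L m \<phi> g t =
     (\<Sum>\<^sub>\<infinity>l\<in>UNIV. g l * of_real
        (sinc (L * pi * (t - of_int l / L)) * \<phi> (t - of_int l / L) *
         indicator {- real m / L..real m / L} (t - of_int l / L)))"

(* Extended-real supremum, so that an upper bound also asserts boundedness. *)
definition C0_norm :: "(real \<Rightarrow> complex) \<Rightarrow> ereal" where
  "C0_norm g = (SUP t. ereal (cmod (g t)))"

end

theory Submission
  imports Defs
begin

text \<open>
  The estimate rests on two facts. The window takes values in $[0,1]$, and the sinc factor alone
  already makes the sum of the absolute values of the kernel grow only logarithmically in $m$.

  For the first, call a function symmetrically decreasing if it is a decreasing function of $|x|$.
  Convolution with an integrable symmetrically decreasing function preserves this property
  (\<open>sym_decreasing_convolve\<close>), so every centered B-spline is nonnegative and attains its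
  maximum at the origin, and dividing by that maximum gives a window bounded by $1$.

  For the second, at a point $t$ with $u = Lt$ the sinc factors are $\mathrm{sinc}(\pi(u-l))$.
  Going outwards from $u$ on either side, the $k$-th integer has distance at least $k$ from $u$,
  counting from $k = 0$. The two innermost terms are at most $1$ and the others at most
  $1/(\pi k)$, so the sum is at most $2 + \frac{2}{\pi} H_m$ with the harmonic number $H_m$
  (\<open>sum_sinc_near_le\<close>). Since $\pi \ge 2$ and $H_m \le \frac32\sqrt m$, this is at most the
  claimed constant. The error at $t$ is a finite sum of noise values against this kernel.
\<close>

section \<open>Symmetrically decreasing functions and B-splines\<close>

definition sym_decreasing :: "(real \<Rightarrow> real) \<Rightarrow> bool" where
  "sym_decreasing f \<longleftrightarrow> (\<forall>x y. \<bar>x\<bar> \<le> \<bar>y\<bar> \<longrightarrow> f y \<le> f x)"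

lemma sym_decreasingD: "sym_decreasing f \<Longrightarrow> \<bar>x\<bar> \<le> \<bar>y\<bar> \<Longrightarrow> f y \<le> f x"
  by (simp add: sym_decreasing_def)

lemma sym_decreasing_eq: "sym_decreasing f \<Longrightarrow> \<bar>x\<bar> = \<bar>y\<bar> \<Longrightarrow> f x = f y"
  using sym_decreasingD[of f x y] sym_decreasingD[of f y x] by simp

lemma integrable_convolve_kernel:
  fixes f g :: "real \<Rightarrow> real"
  assumes f: "integrable lborel f"
    and g: "g \<in> borel_measurable lborel" "\<And>x. \<bar>g x\<bar> \<le> C"
    and [measurable]: "h \<in> borel_measurable lborel"
  shows "integrable lborel (\<lambda>x. f x * g (h x))"
proof (rule Bochner_Integration.integrable_bound)
  show "integrable lborel (\<lambda>x. C * f x)" using f by simp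
  have [measurable]: "f \<in> borel_measurable lborel" using f by simp
  show "(\<lambda>x. f x * g (h x)) \<in> borel_measurable lborel"
    using g(1) by simp
  show "AE x in lborel. norm (f x * g (h x)) \<le> norm (C * f x)"
  proof (rule AE_I2)
    fix x
    have "\<bar>g (h x)\<bar> \<le> \<bar>C\<bar>" using g(2)[of "h x"] by linarith
    then have "\<bar>g (h x)\<bar> * \<bar>f x\<bar> \<le> \<bar>C\<bar> * \<bar>f x\<bar>"
      by (rule mult_right_mono) simp
    then show "norm (f x * g (h x)) \<le> norm (C * f x)"
      by (simp add: abs_mult mult.commute)
  qed
qed

text \<open>
  For $0 \le t \le t'$ the value at $t$ is compared with the value at $t'$ by symmetrization:
  with $d = t' - t$, shifts and reflections show that twice the difference is
  $\int (f(x) - f(x+d))\,(g(t-x) - g(t'+x))\,dx$. Both factors are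
  nonnegative for $x \ge -d/2$ and nonpositive for $x \le -d/2$, because $x$ and $t-x$ are
  at most as large in modulus as $x+d$ and $t'+x$, respectively, in the first case and at least
  as large in the second; so the integrand is nonnegative.
\<close>

lemma sym_decreasing_convolve:
  assumes f: "sym_decreasing f" "integrable lborel f"
    and g: "sym_decreasing g" "g \<in> borel_measurable lborel" "\<And>x. 0 \<le> g x"
  shows "sym_decreasing (convolve f g)"
proof -
  have bnd: "\<bar>g x\<bar> \<le> g 0" for x
    using g(3)[of x] sym_decreasingD[OF g(1), of 0 x] by simp
  have sub: "convolve f g t = (\<integral>x. f (a + c * x) * g (t - (a + c * x)) \<partial>lborel)"
    if "c = 1 \<or> c = -1" for a c t
    unfolding convolve_def
    using that by (subst lborel_integral_real_affine[where c=c and t=a]) auto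
  have even: "convolve f g (- t) = convolve f g t" for t
  proof -
    have "convolve f g (- t) = (\<integral>x. f (0 + - 1 * x) * g (- t - (0 + - 1 * x)) \<partial>lborel)"
      by (rule sub) simp
    also have "\<dots> = (\<integral>x. f x * g (t - x) \<partial>lborel)"
      by (intro Bochner_Integration.integral_cong refl arg_cong2[where f="(*)"]
            sym_decreasing_eq[OF f(1)] sym_decreasing_eq[OF g(1)]) auto
    finally show ?thesis by (simp add: convolve_def)
  qed
  have dec: "convolve f g t' \<le> convolve f g t" if t: "0 \<le> t" "t \<le> t'" for t t'
  proof -
    define d where "d = t' - t"
    have fd: "integrable lborel (\<lambda>x. f (x + d))"
      using lborel_integrable_real_affine[OF f(2), of 1 d] by (simp add: add.commute)
    have int: "integrable lborel (\<lambda>x. F x * g (h x))"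
      if "integrable lborel F" "h \<in> borel_measurable lborel" for F h :: "real \<Rightarrow> real"
      using that g(2) bnd by (intro integrable_convolve_kernel[where C="g 0"])
    have e2: "convolve f g t' = (\<integral>x. f (x + d) * g (t - x) \<partial>lborel)"
      unfolding sub[where a="d" and c="1" and t=t', OF disjI1[OF refl]]
      by (intro Bochner_Integration.integral_cong refl arg_cong2[where f="(*)"]
            sym_decreasing_eq[OF f(1)] sym_decreasing_eq[OF g(1)])
        (simp_all add: d_def)
    have e3: "convolve f g t' = (\<integral>x. f x * g (t' + x) \<partial>lborel)"
      unfolding sub[where a="0" and c="- 1" and t=t', OF disjI2[OF refl]]
      by (intro Bochner_Integration.integral_cong refl arg_cong2[where f="(*)"]
            sym_decreasing_eq[OF f(1)] sym_decreasing_eq[OF g(1)])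
        (simp_all add: d_def)
    have e4: "convolve f g t = (\<integral>x. f (x + d) * g (t' + x) \<partial>lborel)"
      unfolding sub[where a="- d" and c="- 1" and t=t, OF disjI2[OF refl]]
      by (intro Bochner_Integration.integral_cong refl arg_cong2[where f="(*)"]
            sym_decreasing_eq[OF f(1)] sym_decreasing_eq[OF g(1)])
        (simp_all add: d_def)
    have "0 \<le> (\<integral>x. (f x - f (x + d)) * (g (t - x) - g (t' + x)) \<partial>lborel)"
    proof (rule Bochner_Integration.integral_nonneg_AE, rule AE_I2)
      fix x
      show "0 \<le> (f x - f (x + d)) * (g (t - x) - g (t' + x))"
      proof (cases "x \<ge> - d / 2")
        case True
        then have "\<bar>x\<bar> \<le> \<bar>x + d\<bar>" "\<bar>t - x\<bar> \<le> \<bar>t' + x\<bar>" using t by (auto simp: d_def)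
        then show ?thesis
          using sym_decreasingD[OF f(1)] sym_decreasingD[OF g(1)] by simp
      next
        case False
        then have "\<bar>x + d\<bar> \<le> \<bar>x\<bar>" "\<bar>t' + x\<bar> \<le> \<bar>t - x\<bar>" using t by (auto simp: d_def)
        then show ?thesis
          using sym_decreasingD[OF f(1)] sym_decreasingD[OF g(1)]
          by (simp add: mult_nonpos_nonpos)
      qed
    qed
    also have "\<dots> = (\<integral>x. f x * g (t - x) - f x * g (t' + x)
                         - (f (x + d) * g (t - x) - f (x + d) * g (t' + x)) \<partial>lborel)"
      by (simp add: algebra_simps)
    also have "\<dots> = convolve f g t - convolve f g t' - (convolve f g t' - convolve f g t)"
    proof -
      have "(\<integral>x. f x * g (t - x) \<partial>lborel) = convolve f g t" by (simp add: convolve_def)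
      then show ?thesis
        using int[OF f(2), of "\<lambda>x. t - x"] int[OF f(2), of "\<lambda>x. t' + x"]
          int[OF fd, of "\<lambda>x. t - x"] int[OF fd, of "\<lambda>x. t' + x"]
        by (simp add: e2[symmetric] e3[symmetric] e4[symmetric])
    qed
    finally show ?thesis by simp
  qed
  show ?thesis
    unfolding sym_decreasing_def
  proof (intro allI impI)
    fix x y :: real assume "\<bar>x\<bar> \<le> \<bar>y\<bar>"
    then have "convolve f g \<bar>y\<bar> \<le> convolve f g \<bar>x\<bar>" by (intro dec) auto
    then show "convolve f g y \<le> convolve f g x" using even by (simp add: abs_if split: if_splits)
  qed
qed

lemma borel_measurable_convolve:
  assumes [measurable]: "f \<in> borel_measurable lborel" "g \<in> borel_measurable lborel"
  shows "convolve f g \<in> borel_measurable lborel"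
  unfolding convolve_def[abs_def]
  by (rule lborel.borel_measurable_lebesgue_integral) measurable

lemma sym_decreasing_unit_box: "sym_decreasing unit_box"
  unfolding sym_decreasing_def unit_box_def by (auto simp: indicator_def abs_le_iff)

lemma integrable_unit_box: "integrable lborel unit_box"
  unfolding unit_box_def by (rule integrable_real_indicator) auto

lemma cardinal_bspline_sym_decreasing_nonneg:
  "sym_decreasing (cardinal_bspline n) \<and> (\<forall>x. 0 \<le> cardinal_bspline n x)"
proof -
  define P where "P g \<longleftrightarrow> sym_decreasing g \<and> g \<in> borel_measurable lborel \<and> (\<forall>x. 0 \<le> g x)"
    for g :: "real \<Rightarrow> real"
  have box: "P unit_box"
    using sym_decreasing_unit_box borel_measurable_integrable[OF integrable_unit_box]
    unfolding P_def by (auto simp: unit_box_def)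
  have "P (convolve unit_box g)" if "P g" for g
    unfolding P_def
  proof (intro conjI allI)
    have g: "sym_decreasing g" "g \<in> borel_measurable lborel" "\<And>x. 0 \<le> g x"
      using that by (auto simp: P_def)
    show "sym_decreasing (convolve unit_box g)"
      by (rule sym_decreasing_convolve[OF sym_decreasing_unit_box integrable_unit_box g])
    show "convolve unit_box g \<in> borel_measurable lborel"
      by (rule borel_measurable_convolve[OF borel_measurable_integrable[OF integrable_unit_box] g(2)])
    show "0 \<le> convolve unit_box g x" for x
      unfolding convolve_def unit_box_def
      by (rule Bochner_Integration.integral_nonneg) (simp add: g(3))
  qed
  then have "P ((convolve unit_box ^^ k) unit_box)" for k
    using box by (induction k) auto
  then show ?thesis by (simp add: P_def cardinal_bspline_def)
qed

lemma bspline_window_bounds: "0 \<le> bspline_window s L m x" "bspline_window s L m x \<le> 1"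
proof -
  let ?M = "cardinal_bspline (2 * s)"
  have M: "0 \<le> ?M y" "?M y \<le> ?M 0" for y
    using cardinal_bspline_sym_decreasing_nonneg[of "2 * s"]
    by (auto simp: sym_decreasing_def)
  show "0 \<le> bspline_window s L m x" using M by (simp add: bspline_window_def)
  \<comment> \<open>If the maximum were $0$, the convention $1/0 = 0$ would make the window vanish.\<close>
  show "bspline_window s L m x \<le> 1"
    using M[of "L * x * real s / real m"] by (auto simp: bspline_window_def divide_le_eq_1)
qed

section \<open>Sums of sinc values near a point\<close>

text \<open>
  The increment $1/(n+1)$ is at most $\frac32(\sqrt{n+1}-\sqrt n)$, which amounts to
  $\sqrt{n+1}+\sqrt n \le \frac32(n+1)$ and follows from $\sqrt x \le (x+1)/2$.
\<close>

lemma harm_le_sqrt: "harm n \<le> 3/2 * sqrt (real n)"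
proof (induction n)
  case 0
  show ?case by (simp add: harm_def)
next
  case (Suc n)
  define a b where "a = sqrt (real n)" and "b = sqrt (real (Suc n))"
  have ab: "a\<^sup>2 = real n" "b\<^sup>2 = real n + 1" "0 \<le> a" "0 < b" by (auto simp: a_def b_def)
  have "0 \<le> (a - 1)\<^sup>2" "0 \<le> (b - 1)\<^sup>2" by auto
  then have sum: "a + b \<le> 3/2 * (real n + 1)"
    using ab by (simp add: power2_diff)
  have "(b - a) * (a + b) = 1"
    using ab by (simp add: algebra_simps power2_eq_square)
  then have diff: "b - a = 1 / (a + b)"
    using ab by (simp add: field_simps)
  have "inverse (real (Suc n)) \<le> 3/2 * (b - a)"
    unfolding diff using sum ab by (simp add: field_simps)
  then show ?case
    using Suc by (simp add: harm_Suc a_def b_def)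
qed

lemma abs_sinc_le_one: "\<bar>sinc x\<bar> \<le> 1"
  using abs_sin_x_le_abs_x[of x] by (auto simp: divide_le_eq_1)

lemma abs_sinc_le_inverse: "x \<noteq> 0 \<Longrightarrow> \<bar>sinc x\<bar> \<le> 1 / \<bar>x\<bar>"
  using abs_sin_le_one[of x] by (simp add: divide_right_mono)

lemma sum_sinc_one_side_le:
  fixes x :: "nat \<Rightarrow> real"
  assumes "\<And>k. real k \<le> \<bar>x k\<bar>"
  shows "(\<Sum>k\<le>m. \<bar>sinc (pi * x k)\<bar>) \<le> 1 + harm m / pi"
proof -
  have "(\<Sum>k\<le>m. \<bar>sinc (pi * x k)\<bar>)
      = \<bar>sinc (pi * x 0)\<bar> + (\<Sum>k = 1..m. \<bar>sinc (pi * x k)\<bar>)"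
    by (simp add: atMost_atLeast0 sum.atLeast_Suc_atMost)
  also have "\<dots> \<le> 1 + (\<Sum>k = 1..m. inverse (real k) / pi)"
  proof (intro add_mono sum_mono abs_sinc_le_one)
    fix k assume "k \<in> {1..m}"
    then have k: "0 < real k" by simp
    then have nz: "x k \<noteq> 0" using assms[of k] by auto
    then have "\<bar>sinc (pi * x k)\<bar> \<le> 1 / \<bar>pi * x k\<bar>"
      by (intro abs_sinc_le_inverse) auto
    also have "\<dots> \<le> 1 / (pi * real k)"
      using assms[of k] k nz by (intro divide_left_mono) (auto simp: abs_mult)
    finally show "\<bar>sinc (pi * x k)\<bar> \<le> inverse (real k) / pi"
      by (simp add: field_simps)
  qed
  also have "\<dots> = 1 + harm m / pi"
    by (simp add: harm_def sum_divide_distrib)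
  finally show ?thesis .
qed

text \<open>
  The integers within distance $m$ of $u$ are among the $m+1$ nearest ones on each side, which are
  enumerated outwards from \<open>\<lfloor>u\<rfloor>\<close> and from \<open>\<lfloor>u\<rfloor> + 1\<close>.
\<close>

lemma sum_sinc_near_le:
  "(\<Sum>l\<in>{l::int. \<bar>u - of_int l\<bar> \<le> real m}. \<bar>sinc (pi * (u - of_int l))\<bar>)
     \<le> 2 + 2 / pi * harm m" (is "sum ?g ?A \<le> _")
proof -
  define n where "n = \<lfloor>u\<rfloor>"
  have n: "of_int n \<le> u" "u < of_int n + 1" by (auto simp: n_def)
  define p q where "p k = n - int k" and "q k = n + 1 + int k" for k
  have sub: "?A \<subseteq> p ` {..m} \<union> q ` {..m}"
  proof
    fix l assume "l \<in> ?A"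
    then have l: "u \<le> of_int l + real m" "of_int l \<le> u + real m" by auto
    show "l \<in> p ` {..m} \<union> q ` {..m}"
    proof (cases "l \<le> n")
      case True
      have "real_of_int n \<le> of_int (l + int m)" using n l by simp
      then have "n \<le> l + int m" by linarith
      then have "l = p (nat (n - l))" "nat (n - l) \<le> m" using True by (auto simp: p_def)
      then show ?thesis by blast
    next
      case False
      have "real_of_int l < of_int (n + 1 + int m)" using n l by simp
      then have "l < n + 1 + int m" by linarith
      then have "l = q (nat (l - n - 1))" "nat (l - n - 1) \<le> m" using False by (auto simp: q_def)
      then show ?thesis by blast
    qed
  qed
  have "sum ?g ?A \<le> sum ?g (p ` {..m} \<union> q ` {..m})"
    by (rule sum_mono2) (use sub in auto)
  also have "\<dots> \<le> sum ?g (p ` {..m}) + sum ?g (q ` {..m})"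
    using sum_nonneg[of "p ` {..m} \<inter> q ` {..m}" ?g]
    by (subst sum_Un) auto
  also have "sum ?g (p ` {..m}) = (\<Sum>k\<le>m. ?g (p k))"
    by (subst sum.reindex) (auto simp: inj_on_def p_def)
  also have "\<dots> \<le> 1 + harm m / pi"
    by (rule sum_sinc_one_side_le) (use n in \<open>auto simp: p_def\<close>)
  also have "sum ?g (q ` {..m}) = (\<Sum>k\<le>m. ?g (q k))"
    by (subst sum.reindex) (auto simp: inj_on_def q_def)
  also have "\<dots> \<le> 1 + harm m / pi"
    by (rule sum_sinc_one_side_le) (use n in \<open>auto simp: q_def\<close>)
  finally show ?thesis by simp
qed

section \<open>The regularized sampling series\<close>

lemma finite_int_near: "finite {l::int. \<bar>u - of_int l\<bar> \<le> real m}"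
proof (rule finite_subset)
  show "{l::int. \<bar>u - of_int l\<bar> \<le> real m} \<subseteq> {\<lceil>u - real m\<rceil>..\<lfloor>u + real m\<rfloor>}"
    by (auto simp only: mem_Collect_eq atLeastAtMost_iff ceiling_le_iff le_floor_iff abs_le_iff)
qed auto

lemma reg_shannon_eq_sum:
  assumes "0 < L"
  shows "reg_shannon L m \<phi> g t =
    (\<Sum>l\<in>{l::int. \<bar>L * t - of_int l\<bar> \<le> real m}.
       g l * of_real (sinc (pi * (L * t - of_int l)) * \<phi> (t - of_int l / L)))"
proof -
  let ?A = "{l::int. \<bar>L * t - of_int l\<bar> \<le> real m}"
  have arg: "L * pi * (t - of_int l / L) = pi * (L * t - of_int l)" for l
    using assms by (simp add: field_simps)
  have ind: "indicator {- real m / L..real m / L} (t - of_int l / L) = (indicator ?A l :: real)"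
    for l :: int
  proof -
    have scale: "t - of_int l / L = (L * t - of_int l) / L"
      using assms by (simp add: field_simps)
    have "t - of_int l / L \<in> {- real m / L..real m / L} \<longleftrightarrow> l \<in> ?A"
      using assms by (simp add: abs_le_iff pos_le_divide_eq pos_divide_le_eq
          diff_divide_distrib[symmetric] mult.commute scale) linarith
    then show ?thesis by (simp add: indicator_def)
  qed
  have "reg_shannon L m \<phi> g t =
    (\<Sum>\<^sub>\<infinity>l\<in>?A. g l * of_real (sinc (pi * (L * t - of_int l)) * \<phi> (t - of_int l / L)))"
    unfolding reg_shannon_def arg ind by (rule infsum_cong_neutral) auto
  then show ?thesis
    by (simp only: infsum_finite[OF finite_int_near])
qed

lemma norm_reg_shannon_diff_le:
  fixes \<phi> :: "real \<Rightarrow> real" and g h :: "int \<Rightarrow> complex"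
  assumes "0 < L" and phi: "\<And>x. \<bar>\<phi> x\<bar> \<le> 1" and gh: "\<And>l. cmod (g l - h l) \<le> e"
  shows "cmod (reg_shannon L m \<phi> g t - reg_shannon L m \<phi> h t)
     \<le> e * (2 + 2 / pi * harm m)"
proof -
  let ?A = "{l::int. \<bar>L * t - of_int l\<bar> \<le> real m}"
  let ?S = "\<lambda>l::int. sinc (pi * (L * t - of_int l))"
  have e: "0 \<le> e" using gh[of 0] norm_ge_zero order_trans by blast
  have diff: "reg_shannon L m \<phi> g t - reg_shannon L m \<phi> h t
      = (\<Sum>l\<in>?A. (g l - h l) * of_real (?S l * \<phi> (t - of_int l / L)))"
    unfolding reg_shannon_eq_sum[OF assms(1)] sum_subtractf[symmetric] left_diff_distrib ..
  have "cmod (reg_shannon L m \<phi> g t - reg_shannon L m \<phi> h t) \<le> (\<Sum>l\<in>?A. e * \<bar>?S l\<bar>)"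
    unfolding diff
  proof (rule sum_norm_le)
    fix l
    have "cmod (g l - h l) * (\<bar>?S l\<bar> * \<bar>\<phi> (t - of_int l / L)\<bar>) \<le> e * (\<bar>?S l\<bar> * 1)"
      by (intro mult_mono gh phi e) auto
    then show "cmod ((g l - h l) * of_real (?S l * \<phi> (t - of_int l / L))) \<le> e * \<bar>?S l\<bar>"
      by (simp only: norm_mult norm_of_real abs_mult mult_1_right)
  qed
  also have "\<dots> = e * (\<Sum>l\<in>?A. \<bar>?S l\<bar>)"
    by (rule sum_distrib_left[symmetric])
  also have "\<dots> \<le> e * (2 + 2 / pi * harm m)"
    by (rule mult_left_mono[OF sum_sinc_near_le e])
  finally show ?thesis .
qed

theorem theorem5p5:
  fixes N m s :: nat and \<tau> \<delta> lam L \<epsilon> :: real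
    and f :: "real \<Rightarrow> complex" and noise ftilde :: "int \<Rightarrow> complex"
  assumes "N \<ge> 1" and "0 < \<tau>" and "\<tau> < 1/2" and "\<delta> = \<tau> * real N"
    and "lam \<ge> 0" and "L = real N * (1 + lam)" and "m \<ge> 2"
    and "f \<in> paley_wiener \<delta>"
    and "s = nat \<lceil>(real m + 1) / 2\<rceil>"
    and "\<epsilon> > 0"
    and "\<And>l. ftilde l = f (of_int l / L) + noise l"
    and "\<And>l. cmod (noise l) \<le> \<epsilon>"
  shows "C0_norm (\<lambda>t. reg_shannon L m (bspline_window s L m) ftilde t
                    - reg_shannon L m (bspline_window s L m) (\<lambda>l. f (of_int l / L)) t)
         \<le> ereal (\<epsilon> * (2 + 3/2 * sqrt (real m)))"
  unfolding C0_norm_def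
proof (rule SUP_least)
  fix t
  have L: "0 < L" using assms(1,5,6) by simp
  have "cmod (reg_shannon L m (bspline_window s L m) ftilde t
            - reg_shannon L m (bspline_window s L m) (\<lambda>l. f (of_int l / L)) t)
      \<le> \<epsilon> * (2 + 2 / pi * harm m)"
    by (rule norm_reg_shannon_diff_le[OF L])
      (use assms(11,12) bspline_window_bounds[of s L m] in \<open>auto simp: abs_le_iff\<close>)
  also have "2 / pi * harm m \<le> 1 * harm m"
    using pi_ge_two by (intro mult_right_mono harm_nonneg) (simp add: divide_le_eq_1)
  also have "1 * harm m \<le> 3/2 * sqrt (real m)"
    using harm_le_sqrt[of m] by simp
  finally show "ereal (cmod (reg_shannon L m (bspline_window s L m) ftilde t
            - reg_shannon L m (bspline_window s L m) (\<lambda>l. f (of_int l / L)) t))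
      \<le> ereal (\<epsilon> * (2 + 3/2 * sqrt (real m)))"
    using assms(10) by simp
qed

end
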